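(* Let $S$ be a $\Delta$-regular $N\times N$ sign matrix with $\Delta\leq N/2$, and let $B=(S+J)/2$ be its boolean version ($J$ the all-ones matrix). Then $$\|S\|_*\leq\frac{N\cdot\sigma_2(B)}{\Delta}.$$
   Context: A sign matrix is $\Delta$-regular if its boolean version has exactly $\Delta$ ones in every row and every column. $\sigma_2(B)$ is the second largest singular value of $B$. For a sign matrix $S$, $\|S\|_*=\min\{\|M\|: M_{i,j}S_{i,j}\geq 1 \text{ for all } i,j\}$, where $\|M\|$ is the spectral norm (largest singular value) of the real matrix $M$. *)

theory Defs
  imports "HOL-Analysis.Analysis" "HOL-Library.Multiset"
begin

definition singular_space :: "real^'n^'n \<Rightarrow> real \<Rightarrow> (real^'n) set" where
  "singular_space A s = {v. (transpose A ** A) *v v = s\<^sup>2 *\<^sub>R v}"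

text \<open>Square roots of the eigenvalues of \<open>A\<^sup>T A\<close>. Since \<open>A\<^sup>T A\<close> is symmetric, multiplicities can be
  read off as dimensions of eigenspaces, and the list below has \<open>CARD('n)\<close> entries.\<close>

definition singular_values :: "real^'n^'n \<Rightarrow> real list" where
  "singular_values A = rev (sorted_list_of_multiset
     (\<Sum>s | 0 \<le> s \<and> singular_space A s \<noteq> {0}. replicate_mset (dim (singular_space A s)) s))"

text \<open>The \<open>k\<close>-th largest singular value, counted with multiplicity; \<open>k\<close> ranges over \<open>1, \<dots>, CARD('n)\<close>.\<close>

definition sigma_val :: "nat \<Rightarrow> real^'n^'n \<Rightarrow> real" where
  "sigma_val k A = singular_values A ! (k - 1)"

definition spectral_norm :: "real^'n^'n \<Rightarrow> real" where
  "spectral_norm A = sigma_val 1 A"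

definition sign_matrix :: "real^'n^'n \<Rightarrow> bool" where
  "sign_matrix S \<longleftrightarrow> (\<forall>i j. S $ i $ j \<in> {-1, 1})"

definition all_ones :: "real^'n^'n" where
  "all_ones = (\<chi> i j. 1)"

definition boolean_version :: "real^'n^'n \<Rightarrow> real^'n^'n" where
  "boolean_version S = (1/2) *\<^sub>R (S + all_ones)"

definition regular_sign_matrix :: "nat \<Rightarrow> real^'n^'n \<Rightarrow> bool" where
  "regular_sign_matrix \<Delta> S \<longleftrightarrow> sign_matrix S \<and>
     (\<forall>i. card {j. boolean_version S $ i $ j = 1} = \<Delta>) \<and>
     (\<forall>j. card {i. boolean_version S $ i $ j = 1} = \<Delta>)"

text \<open>\<open>LEAST\<close> is the minimum of the attained norms; it exists because the feasible set is closed and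
  non-empty and the spectral norm is a norm on a finite-dimensional space.\<close>

definition sign_star_norm :: "real^'n^'n \<Rightarrow> real" where
  "sign_star_norm S =
     (LEAST r. \<exists>M. (\<forall>i j. M $ i $ j * S $ i $ j \<ge> 1) \<and> r = spectral_norm M)"

end

theory Submission
  imports Defs
begin

text \<open>Take \<open>M = (N/\<Delta>) B - J\<close>; it is feasible because \<open>N/\<Delta> - 1 \<ge> 1\<close>. Regularity gives
  \<open>M 1 = 0 = M\<^sup>T 1\<close>, so a top singular vector \<open>v\<close> of \<open>M\<close>, with singular value \<open>m > 0\<close>, is orthogonal
  to the all-ones vector and hence is a singular vector of \<open>B\<close> with singular value \<open>m\<Delta>/N\<close>. As the
  all-ones vector is a singular vector of \<open>B\<close> for \<open>\<Delta>\<close>, the largest singular value of \<open>B\<close>, the list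
  of singular values of \<open>B\<close> contains both \<open>\<Delta>\<close> and \<open>m\<Delta>/N \<le> \<Delta>\<close>, so \<open>m\<Delta>/N \<le> \<sigma>\<^sub>2(B)\<close>.\<close>

section \<open>Singular values\<close>

text \<open>Writing the action of the Gram matrix as \<open>(A *v v) v* A\<close> avoids transposes;
  \<open>dot_lmul_matrix\<close> then moves the outer factor across an inner product.\<close>

lemma mem_singular_space: "v \<in> singular_space A s \<longleftrightarrow> (A *v v) v* A = s\<^sup>2 *\<^sub>R v"
  by (simp add: singular_space_def flip: matrix_vector_mul_assoc)

lemma inner_gram: "((A *v v) v* A) \<bullet> w = (A *v v) \<bullet> (A *v w)" for A :: "real^'n^'m"
  by (rule dot_lmul_matrix)

lemma singular_space_norm:
  assumes "v \<in> singular_space A s" "0 \<le> s"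
  shows "norm (A *v v) = s * norm v"
proof -
  have "(norm (A *v v))\<^sup>2 = (s * norm v)\<^sup>2"
    using assms(1) inner_gram[of A v v]
    by (simp add: mem_singular_space power2_norm_eq_inner power_mult_distrib)
  then show ?thesis
    using assms(2) by (simp add: power2_eq_iff_nonneg)
qed

text \<open>Both \<open>s\<^sup>2 * (v \<bullet> w)\<close> and
  \<open>t\<^sup>2 * (v \<bullet> w)\<close> equal \<open>(A *v v) \<bullet> (A *v w)\<close>, and
  distinct nonnegative reals have distinct squares.\<close>

lemma orthogonal_singular_spaces:
  assumes "v \<in> singular_space A s" "w \<in> singular_space A t" "0 \<le> s" "0 \<le> t" "s \<noteq> t"
  shows "orthogonal v w"
proof -
  have "s\<^sup>2 * (v \<bullet> w) = t\<^sup>2 * (v \<bullet> w)"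
    using assms(1,2) inner_gram[of A v w] inner_gram[of A w v]
    by (simp add: mem_singular_space inner_commute)
  moreover have "s\<^sup>2 \<noteq> t\<^sup>2"
    using assms(3-5) by (simp add: power2_eq_iff_nonneg)
  ultimately show ?thesis
    by (simp add: orthogonal_def)
qed

lemma singular_space_nontrivial:
  "singular_space A s \<noteq> {0} \<longleftrightarrow> (\<exists>v\<in>singular_space A s. v \<noteq> 0)"
proof -
  have "0 \<in> singular_space A s"
    by (simp add: mem_singular_space)
  then show ?thesis by blast
qed

text \<open>One nonzero vector from each space gives a pairwise orthogonal, hence independent and
  finite, family. Over an infinite index set the sum in \<open>singular_values\<close> would default
  to the empty multiset.\<close>

lemma finite_singular_spaces: "finite {s. 0 \<le> s \<and> singular_space A s \<noteq> {0}}"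
proof -
  define T where "T = {s. 0 \<le> s \<and> singular_space A s \<noteq> {0}}"
  have "\<forall>s\<in>T. \<exists>v. v \<in> singular_space A s \<and> v \<noteq> 0"
    unfolding T_def singular_space_nontrivial by blast
  then obtain f where f: "\<And>s. s \<in> T \<Longrightarrow> f s \<in> singular_space A s" "\<And>s. s \<in> T \<Longrightarrow> f s \<noteq> 0"
    by metis
  have orth: "orthogonal (f s) (f t)" if "s \<in> T" "t \<in> T" "s \<noteq> t" for s t
    using that by (intro orthogonal_singular_spaces[of _ A s _ t] f) (simp_all add: T_def)
  have "inj_on f T"
  proof (rule inj_onI, rule ccontr)
    fix s t assume st: "s \<in> T" "t \<in> T" "f s = f t" "s \<noteq> t"
    then show False
      using orth[of s t] f(2)[of t] by (simp add: orthogonal_def)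
  qed
  moreover have "independent (f ` T)"
  proof (rule pairwise_orthogonal_independent)
    show "pairwise orthogonal (f ` T)"
      unfolding pairwise_image using orth by (simp add: pairwise_def)
    show "0 \<notin> f ` T"
      using f(2) by force
  qed
  then have "finite (f ` T)"
    using independent_bound by blast
  ultimately have "finite T"
    by (simp add: finite_image_iff)
  then show ?thesis
    by (simp add: T_def)
qed

lemma count_singular_values:
  "count (mset (singular_values A)) s =
    (if 0 \<le> s \<and> singular_space A s \<noteq> {0} then dim (singular_space A s) else 0)"
proof -
  have "count (mset (singular_values A)) s =
    (\<Sum>t | 0 \<le> t \<and> singular_space A t \<noteq> {0}. if s = t then dim (singular_space A t) else 0)"
    by (simp add: singular_values_def count_sum eq_commute)
  also have "\<dots> = (if 0 \<le> s \<and> singular_space A s \<noteq> {0} then dim (singular_space A s) else 0)"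
    using finite_singular_spaces[of A] by simp
  finally show ?thesis .
qed

lemma set_singular_values:
  "s \<in> set (singular_values A) \<longleftrightarrow> 0 \<le> s \<and> singular_space A s \<noteq> {0}"
proof -
  have "s \<in> set (singular_values A) \<longleftrightarrow> 0 < count (mset (singular_values A)) s"
    by simp
  moreover have "singular_space A s \<noteq> {0} \<Longrightarrow> 0 < dim (singular_space A s)"
    unfolding singular_space_nontrivial by (auto simp: neq0_conv[symmetric] simp del: neq0_conv)
  ultimately show ?thesis
    unfolding count_singular_values by (cases "singular_space A s = {0}") (simp_all del: dim_eq_0)
qed

lemma sorted_rev_singular_values: "sorted (rev (singular_values A))"
  by (simp add: singular_values_def)

text \<open>Delete one occurrence of \<open>a\<close>; an occurrence of \<open>b\<close> survives,
  even if \<open>a = b\<close>. If it stands before the deleted \<open>a\<close>, then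
  \<open>a\<close> has index at least 1 and bounds \<open>b\<close>; otherwise \<open>b\<close>
  itself has index at least 1.\<close>

lemma ge_nth_1_of_two_le_mset:
  fixes xs :: "'a::linorder list"
  assumes "sorted (rev xs)" "{#a, b#} \<subseteq># mset xs" "b \<le> a"
  shows "b \<le> xs ! 1"
proof -
  have "a \<in> set xs"
    using mset_subset_eqD[OF assms(2), of a] by simp
  then obtain ys zs where xs: "xs = ys @ a # zs"
    by (meson split_list)
  then have "b \<in> set (ys @ zs)"
    using assms(2) by simp
  then obtain k where k: "k < length (ys @ zs)" "(ys @ zs) ! k = b"
    by (meson in_set_conv_nth)
  show ?thesis
  proof (cases "k < length ys")
    case True
    then have "xs ! length ys \<le> xs ! 1"
      using assms(1) xs by (intro sorted_rev_nth_mono) auto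
    then show ?thesis
      using assms(3) xs by auto
  next
    case False
    then have "xs ! Suc k = b"
      using k xs by (simp add: nth_append Suc_diff_le)
    moreover have "xs ! Suc k \<le> xs ! 1"
      using assms(1) xs k by (intro sorted_rev_nth_mono) auto
    ultimately show ?thesis by simp
  qed
qed

lemma le_sigma_val_2:
  assumes "v \<in> singular_space A s" "w \<in> singular_space A t" "v \<noteq> 0" "w \<noteq> 0"
    and "orthogonal v w" "0 \<le> t" "t \<le> s"
  shows "t \<le> sigma_val 2 A"
proof -
  have "0 \<le> s"
    using assms by simp
  have nontriv: "singular_space A s \<noteq> {0}" "singular_space A t \<noteq> {0}"
    using assms(1-4) by auto
  have "{#s, t#} \<subseteq># mset (singular_values A)"
  proof (cases "s = t")
    case True
    \<comment> \<open>With equal values the entry must occur twice; orthogonality makes the singular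
      space at least two-dimensional.\<close>
    have "v \<noteq> w"
      using assms(3,5) by (auto simp: orthogonal_def)
    moreover have "independent {v, w}"
      using assms(3-5) by (intro pairwise_orthogonal_independent)
        (auto simp: pairwise_def orthogonal_commute)
    ultimately have "2 \<le> dim (singular_space A s)"
      using assms(1,2) True independent_card_le_dim[of "{v, w}" "singular_space A s"] by simp
    then show ?thesis
      using True nontriv \<open>0 \<le> s\<close> by (simp add: subseteq_mset_def count_singular_values)
  next
    case False
    have "s \<in> set (singular_values A)" "t \<in> set (singular_values A)"
      using nontriv \<open>0 \<le> s\<close> assms(6) by (simp_all add: set_singular_values)
    then show ?thesis
      using False by (simp add: insert_subset_eq_iff in_diff_count count_eq_zero_iff)
  qed
  then show ?thesis
    unfolding sigma_val_def
    using ge_nth_1_of_two_le_mset[OF sorted_rev_singular_values _ assms(7)] by simp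
qed

section \<open>The spectral norm as an operator norm\<close>

text \<open>Compactness of the unit sphere gives a maximiser, and homogeneity extends its bound to
  all vectors.\<close>

lemma onorm_attained:
  fixes A :: "real^'n^'m"
  obtains v where "norm v = 1" "norm (A *v v) = onorm ((*v) A)"
proof -
  have "sphere (0::real^'n) 1 \<noteq> {}"
    by simp
  then obtain v where v: "v \<in> sphere 0 1"
    and max: "\<And>w. w \<in> sphere 0 1 \<Longrightarrow> norm (A *v w) \<le> norm (A *v v)"
    using continuous_attains_sup[of "sphere 0 1" "\<lambda>v. norm (A *v v)"]
    using continuous_on_norm[OF linear_continuous_on[OF matrix_vector_mul_bounded_linear]]
    by (metis compact_sphere)
  have "norm (A *v x) \<le> norm (A *v v) * norm x" for x
  proof (cases "x = 0")
    case False
    then have "norm (A *v (x /\<^sub>R norm x)) \<le> norm (A *v v)"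
      by (intro max) simp
    then show ?thesis
      using False by (simp add: matrix_vector_mult_scaleR field_simps)
  qed simp
  then have "onorm ((*v) A) \<le> norm (A *v v)"
    by (rule onorm_le)
  moreover have "norm (A *v v) \<le> onorm ((*v) A) * norm v"
    by (simp add: onorm)
  ultimately show ?thesis
    using v that by simp
qed

text \<open>Let the unit vector \<open>v\<close> attain the norm \<open>m\<close>. Its image
  \<open>g\<close> under the Gram matrix has norm at most \<open>m\<^sup>2\<close>, yet
  \<open>g \<bullet> v = m\<^sup>2\<close>; expanding the square of
  \<open>norm (g - m\<^sup>2 *\<^sub>R v)\<close> forces
  \<open>g = m\<^sup>2 *\<^sub>R v\<close>.\<close>

lemma top_singular_vector:
  fixes A :: "real^'n^'n"
  obtains v where "v \<noteq> 0" "v \<in> singular_space A (onorm ((*v) A))"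
proof -
  define m where "m = onorm ((*v) A)"
  obtain v where v: "norm v = 1" "norm (A *v v) = m"
    using onorm_attained[of A] m_def by blast
  define g where "g = (A *v v) v* A"
  have "0 \<le> m"
    using v(2) norm_ge_zero by blast
  have "norm g * norm g = (A *v v) \<bullet> (A *v g)"
    unfolding g_def by (metis inner_gram power2_eq_square power2_norm_eq_inner)
  also have "\<dots> \<le> m * norm (A *v g)"
    using norm_cauchy_schwarz[of "A *v v" "A *v g"] v(2) by simp
  also have "\<dots> \<le> m * (m * norm g)"
    using \<open>0 \<le> m\<close> onorm[of "(*v) A" g] by (simp add: m_def mult_left_mono)
  finally have "norm g \<le> m\<^sup>2"
    by (cases "norm g = 0") (auto simp: power2_eq_square)
  then have "(norm g)\<^sup>2 \<le> (m\<^sup>2)\<^sup>2"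
    by (rule power_mono) simp
  moreover have "g \<bullet> v = m\<^sup>2"
    using v(2) by (metis g_def inner_gram power2_norm_eq_inner)
  moreover have "(norm (g - m\<^sup>2 *\<^sub>R v))\<^sup>2 = (norm g)\<^sup>2 - 2 * m\<^sup>2 * (g \<bullet> v) + (m\<^sup>2)\<^sup>2 * (norm v)\<^sup>2"
    unfolding power2_norm_eq_inner by (simp add: algebra_simps inner_commute power2_eq_square)
  ultimately have "(norm (g - m\<^sup>2 *\<^sub>R v))\<^sup>2 \<le> 0"
    using v(1) by (simp add: power2_eq_square)
  then have "g = m\<^sup>2 *\<^sub>R v"
    by simp
  then have "v \<in> singular_space A (onorm ((*v) A))"
    by (simp add: mem_singular_space g_def m_def)
  moreover have "v \<noteq> 0"
    using v(1) by auto
  ultimately show ?thesis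
    using that by blast
qed

text \<open>The operator norm is itself a singular value, so the head of the decreasing list is no
  smaller; the head is the stretch factor of some singular vector, so it is no larger.\<close>

lemma spectral_norm_eq_onorm: "spectral_norm A = onorm ((*v) A)"
proof -
  let ?m = "onorm ((*v) A)" and ?xs = "singular_values A"
  have "0 \<le> ?m"
    by (simp add: onorm_pos_le)
  then have "?m \<in> set ?xs"
    using top_singular_vector[of A] by (metis set_singular_values singleton_iff)
  then obtain k where k: "k < length ?xs" "?xs ! k = ?m"
    by (meson in_set_conv_nth)
  then have "?m \<le> ?xs ! 0"
    using sorted_rev_nth_mono[OF sorted_rev_singular_values] by (metis le0)
  moreover have "?xs ! 0 \<in> set ?xs"
    using k(1) by (intro nth_mem) linarith
  then obtain v where v: "0 \<le> ?xs ! 0" "v \<in> singular_space A (?xs ! 0)" "v \<noteq> 0"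
    unfolding set_singular_values singular_space_nontrivial by blast
  have "?xs ! 0 * norm v \<le> ?m * norm v"
    using singular_space_norm[OF v(2,1)] onorm[of "(*v) A" v] by simp
  then have "?xs ! 0 \<le> ?m"
    using v(3) by simp
  ultimately show ?thesis
    by (simp add: spectral_norm_def sigma_val_def)
qed

text \<open>Subadditivity makes the operator norm Lipschitz. The constant is the number of matrix
  entries, each of which changes by at most \<open>dist A B\<close>.\<close>

lemma continuous_on_onorm_matrix: "continuous_on X (\<lambda>A::real^'n^'m. onorm ((*v) A))"
proof -
  define C where "C = real CARD('m) * real CARD('n)"
  have le: "onorm ((*v) A) - onorm ((*v) B) \<le> C * dist A B" for A B :: "real^'n^'m"
  proof -
    have "\<bar>(A - B) $ i $ j\<bar> \<le> dist A B" for i j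
      using component_le_norm_cart[of "(A - B) $ i" j] Finite_Cartesian_Product.norm_nth_le[of "A - B" i]
      by (simp add: dist_norm)
    then have "onorm ((*v) (A - B)) \<le> C * dist A B"
      unfolding C_def by (rule onorm_le_matrix_component)
    moreover have "onorm (\<lambda>x. (A - B) *v x + B *v x) \<le> onorm ((*v) (A - B)) + onorm ((*v) B)"
      by (intro onorm_triangle) simp_all
    then have "onorm ((*v) A) \<le> onorm ((*v) (A - B)) + onorm ((*v) B)"
      by (simp add: matrix_vector_mult_diff_rdistrib)
    ultimately show ?thesis by simp
  qed
  have "C-lipschitz_on X (\<lambda>A::real^'n^'m. onorm ((*v) A))"
  proof (rule lipschitz_onI)
    fix A B :: "real^'n^'m"
    show "dist (onorm ((*v) A)) (onorm ((*v) B)) \<le> C * dist A B"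
      using le[of A B] le[of B A] by (simp add: dist_real_def dist_commute abs_le_iff)
  qed (simp add: C_def)
  then show ?thesis
    by (rule lipschitz_on_continuous_on)
qed

text \<open>Every entry is at most the operator norm in absolute value. The estimate makes sublevel
  sets of the operator norm bounded.\<close>

lemma norm_le_onorm_matrix:
  fixes A :: "real^'n^'m"
  shows "norm A \<le> real CARD('m) * real CARD('n) * onorm ((*v) A)"
proof -
  have "norm A \<le> (\<Sum>i\<in>UNIV. norm (A $ i))"
    by (simp add: norm_vec_def L2_set_le_sum)
  also have "\<dots> \<le> (\<Sum>i\<in>(UNIV::'m set). \<Sum>j\<in>(UNIV::'n set). onorm ((*v) A))"
    by (intro sum_mono order_trans[OF norm_le_l1_cart] matrix_component_le_onorm)
  finally show ?thesis
    by (simp add: mult.assoc)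
qed

lemma sign_star_norm_le:
  fixes M S :: "real^'n^'n"
  assumes feasible: "\<And>i j. 1 \<le> M $ i $ j * S $ i $ j"
  shows "sign_star_norm S \<le> onorm ((*v) M)"
proof -
  define F where "F = {A. \<forall>i j. 1 \<le> A $ i $ j * S $ i $ j}"
  \<comment> \<open>Feasible matrices no worse than \<open>M\<close>: unlike \<open>F\<close>, this
    set is bounded, so compactness yields the minimiser that determines
    \<open>LEAST\<close>.\<close>
  define K where "K = F \<inter> {A. onorm ((*v) A) \<le> onorm ((*v) M)}"
  have "closed F"
    unfolding F_def by (intro closed_Collect_all closed_Collect_le continuous_intros)
  moreover have "closed {A::real^'n^'n. onorm ((*v) A) \<le> onorm ((*v) M)}"
    by (intro closed_Collect_le continuous_on_onorm_matrix continuous_intros)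
  moreover have "bounded K"
  proof (rule boundedI)
    fix A assume "A \<in> K"
    then show "norm A \<le> real CARD('n) * real CARD('n) * onorm ((*v) M)"
      unfolding K_def using norm_le_onorm_matrix[of A]
      by (auto elim!: order_trans intro!: mult_left_mono)
  qed
  ultimately have "compact K"
    by (simp add: K_def compact_eq_bounded_closed closed_Int)
  moreover have "M \<in> K"
    using feasible by (simp add: K_def F_def)
  ultimately obtain A where A: "A \<in> K" "\<And>B. B \<in> K \<Longrightarrow> onorm ((*v) A) \<le> onorm ((*v) B)"
    using continuous_attains_inf[of K "\<lambda>A. onorm ((*v) A)"] continuous_on_onorm_matrix by blast
  have "sign_star_norm S = onorm ((*v) A)"
    unfolding sign_star_norm_def spectral_norm_eq_onorm
  proof (rule Least_equality)
    show "\<exists>B. (\<forall>i j. 1 \<le> B $ i $ j * S $ i $ j) \<and> onorm ((*v) A) = onorm ((*v) B)"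
      using A(1) by (auto simp: K_def F_def)
    fix r assume "\<exists>B. (\<forall>i j. 1 \<le> B $ i $ j * S $ i $ j) \<and> r = onorm ((*v) B)"
    then obtain B where B: "B \<in> F" "r = onorm ((*v) B)"
      by (auto simp: F_def)
    \<comment> \<open>A feasible \<open>B\<close> outside \<open>K\<close> has norm above that of
      \<open>M\<close>, hence above the minimum over \<open>K\<close>.\<close>
    then show "onorm ((*v) A) \<le> r"
      using A by (cases "B \<in> K") (auto simp: K_def)
  qed
  then show ?thesis
    using A(1) by (simp add: K_def)
qed

section \<open>Regular matrices\<close>

text \<open>Schur's test: Cauchy-Schwarz in each row with weights \<open>B $ i $ j\<close> uses the
  row sums, and exchanging the two summations uses the column sums.\<close>

lemma norm_mult_le_of_regular:
  fixes B :: "real^'n^'m"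
  assumes nonneg: "\<And>i j. 0 \<le> B $ i $ j"
    and row: "\<And>i. (\<Sum>j\<in>UNIV. B $ i $ j) = d" and col: "\<And>j. (\<Sum>i\<in>UNIV. B $ i $ j) = d"
  shows "norm (B *v x) \<le> d * norm x"
proof -
  have "0 \<le> d"
    using row nonneg by (metis sum_nonneg)
  have "(norm (B *v x))\<^sup>2 = (\<Sum>i\<in>UNIV. (\<Sum>j\<in>UNIV. B $ i $ j * x $ j)\<^sup>2)"
    unfolding power2_norm_eq_inner by (simp add: inner_vec_def matrix_vector_mult_def power2_eq_square)
  also have "\<dots> \<le> (\<Sum>i\<in>UNIV. d * (\<Sum>j\<in>UNIV. B $ i $ j * (x $ j)\<^sup>2))"
  proof (rule sum_mono)
    fix i
    \<comment> \<open>Each term is split as \<open>sqrt (B $ i $ j)\<close> times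
      \<open>sqrt (B $ i $ j) * x $ j\<close>; the squares of the first factors sum to
      \<open>d\<close>.\<close>
    show "(\<Sum>j\<in>UNIV. B $ i $ j * x $ j)\<^sup>2 \<le> d * (\<Sum>j\<in>UNIV. B $ i $ j * (x $ j)\<^sup>2)"
      using Cauchy_Schwarz_ineq_sum[of "\<lambda>j. sqrt (B $ i $ j)" "\<lambda>j. sqrt (B $ i $ j) * x $ j" UNIV]
      by (simp add: nonneg row power_mult_distrib flip: mult.assoc)
  qed
  also have "\<dots> = d * (\<Sum>j\<in>UNIV. \<Sum>i\<in>UNIV. B $ i $ j * (x $ j)\<^sup>2)"
    by (subst sum.swap) (simp add: sum_distrib_left)
  also have "\<dots> = d * (\<Sum>j\<in>UNIV. d * (x $ j)\<^sup>2)"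
    by (simp add: col flip: sum_distrib_right)
  also have "\<dots> = (d * norm x)\<^sup>2"
    unfolding power_mult_distrib power2_norm_eq_inner
    by (simp add: inner_vec_def sum_distrib_left power2_eq_square mult.assoc)
  finally show ?thesis
    by (rule power2_le_imp_le) (simp add: \<open>0 \<le> d\<close>)
qed

lemma regular_sign_matrix_entries:
  assumes "regular_sign_matrix \<Delta> S"
  shows "boolean_version S $ i $ j = 0 \<and> S $ i $ j = -1 \<or> boolean_version S $ i $ j = 1 \<and> S $ i $ j = 1"
proof -
  have "S $ i $ j \<in> {-1, 1}"
    using assms unfolding regular_sign_matrix_def sign_matrix_def by blast
  then show ?thesis
    by (auto simp: boolean_version_def all_ones_def)
qed

lemma regular_sign_matrix_sums:
  assumes "regular_sign_matrix \<Delta> S"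
  shows "(\<Sum>j\<in>UNIV. boolean_version S $ i $ j) = real \<Delta>"
    and "(\<Sum>i\<in>UNIV. boolean_version S $ i $ j) = real \<Delta>"
proof -
  have ind: "boolean_version S $ i $ j = (if boolean_version S $ i $ j = 1 then 1 else 0)" for i j
    using regular_sign_matrix_entries[OF assms, of i j] by auto
  have "(\<Sum>j\<in>UNIV. boolean_version S $ i $ j) = real (card {j. boolean_version S $ i $ j = 1})"
    by (subst ind) (simp add: sum.If_cases)
  then show "(\<Sum>j\<in>UNIV. boolean_version S $ i $ j) = real \<Delta>"
    using assms by (simp add: regular_sign_matrix_def)
  have "(\<Sum>i\<in>UNIV. boolean_version S $ i $ j) = real (card {i. boolean_version S $ i $ j = 1})"
    by (subst ind) (simp add: sum.If_cases)
  then show "(\<Sum>i\<in>UNIV. boolean_version S $ i $ j) = real \<Delta>"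
    using assms by (simp add: regular_sign_matrix_def)
qed

lemma all_ones_mult: "all_ones *v x = (1 \<bullet> x) *\<^sub>R 1" "x v* all_ones = (1 \<bullet> x) *\<^sub>R 1"
  by (simp_all add: vec_eq_iff all_ones_def matrix_vector_mult_def vector_matrix_mult_def inner_vec_def)

theorem theorem26:
  fixes S :: "real^'n^'n" and \<Delta> :: nat
  assumes "regular_sign_matrix \<Delta> S"
    and "0 < \<Delta>"
    and "real \<Delta> \<le> real CARD('n) / 2"
  shows "sign_star_norm S \<le> real CARD('n) * sigma_val 2 (boolean_version S) / real \<Delta>"
proof -
  define B where "B = boolean_version S"
  define d where "d = real \<Delta>"
  \<comment> \<open>This scaling gives \<open>c *\<^sub>R B\<close> the same row and column sums as
    \<open>all_ones\<close>.\<close>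
  define c where "c = real CARD('n) / d"
  define M where "M = c *\<^sub>R B - all_ones"
  define m where "m = onorm ((*v) M)"
  define one :: "real^'n" where "one = 1"
  have "0 < d" "2 \<le> c"
    using assms(2,3) by (simp_all add: c_def d_def field_simps)
  have entries: "B $ i $ j = 0 \<and> S $ i $ j = -1 \<or> B $ i $ j = 1 \<and> S $ i $ j = 1" for i j
    unfolding B_def using assms(1) by (rule regular_sign_matrix_entries)
  have row: "(\<Sum>j\<in>UNIV. B $ i $ j) = d" and col: "(\<Sum>i\<in>UNIV. B $ i $ j) = d" for i j
    unfolding B_def d_def by (rule regular_sign_matrix_sums[OF assms(1)])+
  have B_one: "B *v one = d *\<^sub>R one" "one v* B = d *\<^sub>R one"
    by (simp_all add: vec_eq_iff one_def matrix_vector_mult_def vector_matrix_mult_def row col)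
  have J_mult: "all_ones *v x = (one \<bullet> x) *\<^sub>R one" "x v* all_ones = (one \<bullet> x) *\<^sub>R one" for x :: "real^'n"
    unfolding one_def by (rule all_ones_mult)+
  have M_mult: "M *v x = c *\<^sub>R (B *v x) - (one \<bullet> x) *\<^sub>R one"
    "x v* M = c *\<^sub>R (x v* B) - (one \<bullet> x) *\<^sub>R one" for x
    by (simp_all add: M_def J_mult matrix_vector_mult_diff_rdistrib vector_matrix_mult_diff_rdistrib
        vector_scaleR_matrix_ac flip: scaleR_matrix_vector_assoc)
  have "one \<bullet> one = c * d"
    using \<open>0 < d\<close> by (simp add: one_def c_def inner_vec_def)
  then have M_one: "M *v one = 0"
    by (simp add: M_mult B_one)

  \<comment> \<open>Where \<open>S\<close> is 1 the product is \<open>c - 1\<close>; where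
    \<open>S\<close> is -1 it is 1.\<close>
  have feasible: "1 \<le> M $ i $ j * S $ i $ j" for i j
    using entries[of i j] \<open>2 \<le> c\<close> by (auto simp: M_def all_ones_def)
  \<comment> \<open>A nonzero entry makes \<open>m\<close> positive, so that
    \<open>m\<^sup>2\<close> can be cancelled when orthogonality to \<open>one\<close> is
    derived.\<close>
  have "M $ i $ j \<noteq> 0" for i j
    using feasible[of i j] by auto
  then have "0 < m"
    unfolding m_def using matrix_component_le_onorm[of M] by (metis order_less_le_trans zero_less_abs_iff)
  obtain v where v: "v \<noteq> 0" "(M *v v) v* M = m\<^sup>2 *\<^sub>R v"
    using top_singular_vector[of M] by (auto simp: m_def mem_singular_space)
  have "m\<^sup>2 * (v \<bullet> one) = 0"
    using inner_gram[of M v one] by (simp add: v M_one)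
  then have orth: "one \<bullet> v = 0"
    using \<open>0 < m\<close> by (simp add: inner_commute)
  \<comment> \<open>The \<open>all_ones\<close> part must vanish a second time, when
    \<open>M\<close> acts from the right on \<open>B *v v\<close>; this holds because
    \<open>one\<close> is a left eigenvector of \<open>B\<close>.\<close>
  have "one \<bullet> (B *v v) = 0"
    using orth B_one(2) by (simp flip: dot_lmul_matrix)
  then have "(M *v v) v* M = c\<^sup>2 *\<^sub>R ((B *v v) v* B)"
    by (simp add: M_mult orth power2_eq_square scaleR_vector_matrix_assoc)
  then have "c\<^sup>2 *\<^sub>R ((B *v v) v* B) = c\<^sup>2 *\<^sub>R ((m / c)\<^sup>2 *\<^sub>R v)"
    using v(2) \<open>2 \<le> c\<close> by (simp add: power_divide)
  then have v_B: "v \<in> singular_space B (m / c)"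
    unfolding mem_singular_space using \<open>2 \<le> c\<close> by (subst (asm) scaleR_cancel_left) auto
  have one_B: "one \<in> singular_space B d"
    by (simp add: mem_singular_space B_one power2_eq_square scaleR_vector_matrix_assoc)
  have "0 \<le> m / c"
    using \<open>0 < m\<close> \<open>2 \<le> c\<close> by simp
  \<comment> \<open>By Schur's test \<open>B\<close> stretches no vector by more than
    \<open>d\<close>, so of the two singular values \<open>d\<close> and \<open>m / c\<close> the
    latter is the smaller or equal one.\<close>
  have "0 \<le> B $ i $ j" for i j
    using entries[of i j] by auto
  then have "m / c * norm v \<le> d * norm v"
    using norm_mult_le_of_regular[OF _ row col, of v] singular_space_norm[OF v_B \<open>0 \<le> m / c\<close>] by simp
  then have "m / c \<le> d"
    using v(1) mult_right_le_imp_le[of "m / c" "norm v" d] by simp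
  have "one \<noteq> 0"
    by (simp add: one_def)
  have "m / c \<le> sigma_val 2 B"
    using le_sigma_val_2[OF one_B v_B \<open>one \<noteq> 0\<close> v(1) _ \<open>0 \<le> m / c\<close> \<open>m / c \<le> d\<close>] orth
    by (simp add: orthogonal_def)
  then have "m \<le> c * sigma_val 2 B"
    using \<open>2 \<le> c\<close> by (simp add: field_simps)
  moreover have "sign_star_norm S \<le> m"
    unfolding m_def by (rule sign_star_norm_le[OF feasible])
  ultimately show ?thesis
    by (simp add: c_def d_def B_def)
qed

end
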